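(* Let $m,n$ be positive integers with $1\le n\le \frac{m}{2}$, and let $G$ be a finite simple graph with minimum degree $\delta(G)\geq 1+n$ and isolated toughness $I(G)\geq \frac{1}{m-n}$. Then for every $n$-element subset $E'\subset E(G)$, the graph $G-E'$ has an $S(m)$-factor, i.e. a $[1,m]$-factor.
   Context: For a graph $G$ and $S\subseteq V(G)$, $i(G-S)$ denotes the number of isolated vertices of $G-S$. The isolated toughness of $G$ is $I(G)=\min\{|S|/i(G-S): S\subseteq V(G),\ i(G-S)\geq 2\}$ if $G$ is not complete, and $I(G)=|V(G)|-1$ if $G$ is complete. An $S(m)$-factor (star-factor) of $G$ is a $[1,m]$-factor, i.e. a spanning subgraph $H$ with $1\le d_H(x)\le m$ for all $x\in V(G)$. *)

theory Defs
  imports Complex_Main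
begin

record 'a graph =
  verts :: "'a set"
  edges :: "'a set set"

definition simple_graph :: "'a graph \<Rightarrow> bool" where
  "simple_graph G \<longleftrightarrow> finite (verts G) \<and> (\<forall>e\<in>edges G. e \<subseteq> verts G \<and> card e = 2)"

definition degree :: "'a graph \<Rightarrow> 'a \<Rightarrow> nat" where
  "degree G x = card {e \<in> edges G. x \<in> e}"

text \<open>The value on the graph with no vertices is unspecified.\<close>

definition min_degree :: "'a graph \<Rightarrow> nat" where
  "min_degree G = Min (degree G ` verts G)"

definition delete_verts :: "'a graph \<Rightarrow> 'a set \<Rightarrow> 'a graph" where
  "delete_verts G S = \<lparr>verts = verts G - S, edges = {e \<in> edges G. e \<inter> S = {}}\<rparr>"

definition delete_edges :: "'a graph \<Rightarrow> 'a set set \<Rightarrow> 'a graph" where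
  "delete_edges G F = \<lparr>verts = verts G, edges = edges G - F\<rparr>"

definition complete_graph :: "'a graph \<Rightarrow> bool" where
  "complete_graph G \<longleftrightarrow> (\<forall>x\<in>verts G. \<forall>y\<in>verts G. x \<noteq> y \<longrightarrow> {x, y} \<in> edges G)"

definition num_isolated :: "'a graph \<Rightarrow> nat" where
  "num_isolated G = card {x \<in> verts G. degree G x = 0}"

text \<open>If \<open>G\<close> is simple and not complete, the set below is finite and nonempty:
  for nonadjacent \<open>x \<noteq> y\<close>, deleting all vertices except \<open>x\<close> and \<open>y\<close> leaves two isolated vertices.\<close>

definition isolated_toughness :: "'a graph \<Rightarrow> real" where
  "isolated_toughness G =
    (if complete_graph G then real (card (verts G)) - 1
     else Min {real (card S) / real (num_isolated (delete_verts G S)) | S.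
                 S \<subseteq> verts G \<and> num_isolated (delete_verts G S) \<ge> 2})"

definition spanning_subgraph :: "'a graph \<Rightarrow> 'a graph \<Rightarrow> bool" where
  "spanning_subgraph H G \<longleftrightarrow> simple_graph H \<and> verts H = verts G \<and> edges H \<subseteq> edges G"

definition interval_factor :: "nat \<Rightarrow> nat \<Rightarrow> 'a graph \<Rightarrow> 'a graph \<Rightarrow> bool" where
  "interval_factor a b H G \<longleftrightarrow>
    spanning_subgraph H G \<and> (\<forall>x\<in>verts G. a \<le> degree H x \<and> degree H x \<le> b)"

definition star_factor :: "nat \<Rightarrow> 'a graph \<Rightarrow> 'a graph \<Rightarrow> bool" where
  "star_factor m H G \<longleftrightarrow> interval_factor 1 m H G"

end

theory Submission imports Defs begin

text \<open>
  The core is the star-factor criterion of Las Vergnas and Amahashi--Kano: for \<open>m \<ge> 2\<close>, a graph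
  \<open>G\<close> has a \<open>[1,m]\<close>-factor if \<open>i(G - S) \<le> m |S|\<close> for all \<open>S\<close>. This condition implies
  \<open>|W| \<le> m |N(W)|\<close> for every vertex set \<open>W\<close>, so Hall's theorem with capacities yields a map \<open>f\<close>
  sending each vertex to a neighbour, with fibres of size at most \<open>m\<close>. The edges \<open>{v, f v}\<close> cover all
  vertices with degrees at most \<open>m + 1\<close>; among the sets \<open>D\<close> such that the edges \<open>{v, f v}\<close>
  with \<open>v \<in> D\<close> still cover, one minimising the number of \<open>v \<in> D\<close> with \<open>f v \<in> D\<close> has
  all degrees at most \<open>m\<close>.

  For \<open>G - E'\<close>, deleting \<open>n\<close> edges creates at most \<open>2n\<close> new isolated vertices, so a violation of the
  criterion at \<open>S\<close> contradicts the isolated toughness unless \<open>|S| \<le> 1\<close>. In that case the degree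
  condition forces each of the at least \<open>m |S| + 1\<close> isolated vertices to lie on all edges of \<open>E'\<close>
  and \<open>|S| = 1\<close>, which is impossible for more than two vertices.
\<close>

section \<open>Hall's theorem, plain and with capacities\<close>

text \<open>Induction on \<open>card I\<close>. If a nonempty proper \<open>J\<close> is tight,
  \<open>J\<close> and \<open>I - J\<close> are solved separately, the latter outside the union over
  \<open>J\<close>. Otherwise every nonempty proper subfamily has a surplus, so any element of any
  \<open>A i\<close> can be committed to \<open>i\<close>.\<close>

lemma hall_representatives:
  fixes A :: "'i \<Rightarrow> 'b set"
  assumes "finite I" and "\<And>i. i \<in> I \<Longrightarrow> finite (A i)"
    and "\<And>J. J \<subseteq> I \<Longrightarrow> card J \<le> card (\<Union>(A ` J))"
  shows "\<exists>R. (\<forall>i\<in>I. R i \<in> A i) \<and> inj_on R I"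
  using assms
proof (induction "card I" arbitrary: I A rule: less_induct)
  case less
  note fin = less.prems(1) and finA = less.prems(2) and hall = less.prems(3)
  show ?case
  proof (cases "I = {}")
    case True
    then show ?thesis by simp
  next
    case False
    show ?thesis
    proof (cases "\<exists>J. J \<subset> I \<and> J \<noteq> {} \<and> card (\<Union>(A ` J)) = card J")
      case True
      then obtain J where J: "J \<subset> I" "J \<noteq> {}" "card (\<Union>(A ` J)) = card J" by blast
      have finJ: "finite J" using J fin finite_subset by blast
      have "card J < card I" using J fin psubset_card_mono by blast
      then have "\<exists>R. (\<forall>i\<in>J. R i \<in> A i) \<and> inj_on R J"
        using finJ
      proof (rule less.hyps)
        show "finite (A i)" if "i \<in> J" for i using that J finA by auto
        show "card K \<le> card (\<Union>(A ` K))" if "K \<subseteq> J" for K using that J by (intro hall) auto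
      qed
      then obtain R where R: "\<forall>i\<in>J. R i \<in> A i" "inj_on R J" by blast
      define U where "U = \<Union>(A ` J)"
      have finU: "finite U" unfolding U_def using finJ finA J by auto
      have "card (I - J) < card I"
        using J fin by (intro psubset_card_mono) auto
      moreover have "card K \<le> card (\<Union>((\<lambda>i. A i - U) ` K))" if K: "K \<subseteq> I - J" for K
      proof -
        have finK: "finite K" using K fin finite_subset by blast
        have finUK: "finite (\<Union>((\<lambda>i. A i - U) ` K))" using finK K finA by auto
        \<comment> \<open>Hall's condition for \<open>K \<union> J\<close>, minus the equality for
          the tight \<open>J\<close>, is the condition for \<open>K\<close> outside
          \<open>U\<close>.\<close>
        have "card K + card J = card (K \<union> J)"
          using K finK finJ by (subst card_Un_disjoint) auto
        also have "\<dots> \<le> card (\<Union>(A ` (K \<union> J)))" using K J by (intro hall) auto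
        also have "\<Union>(A ` (K \<union> J)) = \<Union>((\<lambda>i. A i - U) ` K) \<union> U" unfolding U_def by auto
        also have "card \<dots> = card (\<Union>((\<lambda>i. A i - U) ` K)) + card U"
          using finUK finU by (subst card_Un_disjoint) auto
        finally show ?thesis using J U_def by simp
      qed
      ultimately have "\<exists>Q. (\<forall>i\<in>I - J. Q i \<in> A i - U) \<and> inj_on Q (I - J)"
        using fin finA by (intro less.hyps) auto
      then obtain Q where Q: "\<forall>i\<in>I - J. Q i \<in> A i - U" "inj_on Q (I - J)" by blast
      let ?R = "\<lambda>i. if i \<in> J then R i else Q i"
      have "\<forall>i\<in>I. ?R i \<in> A i" using R Q by auto
      moreover have "inj_on ?R I"
      proof (rule inj_onI)
        have ne: "R i \<noteq> Q k" if "i \<in> J" "k \<in> I - J" for i k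
          using that R(1) Q(1) unfolding U_def by force
        fix x y assume "x \<in> I" "y \<in> I" "?R x = ?R y"
        then show "x = y"
          using R(2) Q(2) ne[of x y] ne[of y x] by (cases "x \<in> J"; cases "y \<in> J") (auto dest: inj_onD)
      qed
      ultimately show ?thesis by (intro exI[of _ ?R]) simp
    next
      case noTight: False
      obtain i where i: "i \<in> I" using False by blast
      have "card {i} \<le> card (\<Union>(A ` {i}))" using i by (intro hall) auto
      then have "A i \<noteq> {}" by auto
      then obtain a where a: "a \<in> A i" by blast
      have "card (I - {i}) < card I" using fin i by (rule card_Diff1_less)
      moreover have "card K \<le> card (\<Union>((\<lambda>j. A j - {a}) ` K))" if K: "K \<subseteq> I - {i}" for K
      proof (cases "K = {}")
        case False
        have "card K \<le> card (\<Union>(A ` K))" using K by (intro hall) auto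
        \<comment> \<open>\<open>K\<close> misses \<open>i\<close>, so it is proper and not tight;
          the surplus of one pays for the loss of \<open>a\<close>.\<close>
        moreover have "card (\<Union>(A ` K)) \<noteq> card K" using noTight K i False by blast
        ultimately have "card K < card (\<Union>(A ` K))" by simp
        moreover have "\<Union>((\<lambda>j. A j - {a}) ` K) = \<Union>(A ` K) - {a}" by auto
        moreover have "card (\<Union>(A ` K) - {a}) \<ge> card (\<Union>(A ` K)) - 1"
          using diff_card_le_card_Diff[of "{a}" "\<Union>(A ` K)"] by simp
        ultimately show ?thesis by simp
      qed simp
      ultimately have "\<exists>Q. (\<forall>j\<in>I - {i}. Q j \<in> A j - {a}) \<and> inj_on Q (I - {i})"
        using fin finA by (intro less.hyps) auto
      then obtain Q where Q: "\<forall>j\<in>I - {i}. Q j \<in> A j - {a}" "inj_on Q (I - {i})" by blast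
      let ?R = "\<lambda>j. if j = i then a else Q j"
      have "\<forall>j\<in>I. ?R j \<in> A j" using a Q by auto
      moreover have "inj_on ?R I"
      proof (rule inj_onI)
        fix x y assume "x \<in> I" "y \<in> I" "?R x = ?R y"
        then show "x = y" using Q by (auto split: if_splits dest: inj_onD)
      qed
      ultimately show ?thesis by (intro exI[of _ ?R]) simp
    qed
  qed
qed

text \<open>Giving each \<open>b\<close> as \<open>m\<close> labelled copies turns the capacity into
  injectivity; forgetting the labels gives \<open>f\<close>.\<close>

lemma hall_capacity:
  fixes A :: "'i \<Rightarrow> 'b set"
  assumes fin: "finite I" and finA: "\<And>i. i \<in> I \<Longrightarrow> finite (A i)"
    and hall: "\<And>J. J \<subseteq> I \<Longrightarrow> card J \<le> m * card (\<Union>(A ` J))"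
  shows "\<exists>f. (\<forall>i\<in>I. f i \<in> A i) \<and> (\<forall>b. card {i \<in> I. f i = b} \<le> m)"
proof -
  let ?B = "\<lambda>i. A i \<times> {..<m}"
  have "card J \<le> card (\<Union>(?B ` J))" if "J \<subseteq> I" for J
  proof -
    have "\<Union>(?B ` J) = \<Union>(A ` J) \<times> {..<m}" by auto
    then show ?thesis using hall[OF that] by (simp add: card_cartesian_product mult.commute)
  qed
  then obtain R where R: "\<forall>i\<in>I. R i \<in> ?B i" "inj_on R I"
    using hall_representatives[of I ?B] fin finA by auto
  have "card {i \<in> I. fst (R i) = b} \<le> m" for b
  proof -
    have "card {i \<in> I. fst (R i) = b} = card (R ` {i \<in> I. fst (R i) = b})"
      using R(2) by (intro card_image[symmetric] inj_on_subset[OF R(2)]) auto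
    also have "\<dots> \<le> card ({b} \<times> {..<m})"
      using R(1) by (intro card_mono) fastforce+
    finally show ?thesis by (simp add: card_cartesian_product)
  qed
  then show ?thesis using R(1) by (intro exI[of _ "\<lambda>i. fst (R i)"]) auto
qed

section \<open>Covers by edges of a fixed-point-free map\<close>

text \<open>A vertex \<open>v\<close> collects at most \<open>m\<close> from its fibre and one from
  itself, so the bound can fail only if \<open>v\<close> and its whole fibre lie in
  \<open>D\<close>. Then \<open>v\<close> is covered without its own edge, which contradicts a
  minimal choice of \<open>D\<close>.\<close>

lemma functional_cover_bounded_degree:
  fixes f :: "'a \<Rightarrow> 'a"
  assumes fin: "finite V" and fV: "\<And>v. v \<in> V \<Longrightarrow> f v \<in> V" and fne: "\<And>v. v \<in> V \<Longrightarrow> f v \<noteq> v"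
    and fibre: "\<And>u. card {v \<in> V. f v = u} \<le> m" and m: "m \<ge> 2"
  shows "\<exists>D \<subseteq> V. (\<forall>v\<in>V. v \<in> D \<or> (\<exists>u\<in>D. f u = v)) \<and>
    (\<forall>v\<in>V. card {u \<in> D. u = v \<or> f u = v} \<le> m)"
proof -
  define covers where "covers D \<longleftrightarrow> D \<subseteq> V \<and> (\<forall>v\<in>V. v \<in> D \<or> (\<exists>u\<in>D. f u = v))" for D
  \<comment> \<open>The size of \<open>D\<close> would not do as a measure: exchanging
    \<open>v\<close> for \<open>f v\<close> may preserve it, while \<open>\<Phi>\<close>
    drops.\<close>
  define \<Phi> where "\<Phi> D = card {a \<in> D. f a \<in> D}" for D
  have "covers V" unfolding covers_def by auto
  then obtain D where D: "covers D" and Dmin: "\<And>D'. covers D' \<Longrightarrow> \<Phi> D \<le> \<Phi> D'"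
    using ex_has_least_nat[of covers V \<Phi>] by blast
  have DV: "D \<subseteq> V" and cov: "\<And>v. v \<in> V \<Longrightarrow> v \<in> D \<or> (\<exists>u\<in>D. f u = v)"
    using D unfolding covers_def by auto
  have finD: "finite D" using DV fin finite_subset by blast
  have "card {u \<in> D. u = v \<or> f u = v} \<le> m" if v: "v \<in> V" for v
  proof (rule ccontr)
    assume big: "\<not> ?thesis"
    define P where "P = {u \<in> D. f u = v}"
    define w where "w = f v"
    have finP: "finite P" unfolding P_def using finD by simp
    have Pm: "card P \<le> m"
      using card_mono[of "{u \<in> V. f u = v}" P] fibre[of v] fin DV unfolding P_def by fastforce
    have vD: "v \<in> D"
    proof (rule ccontr)
      assume "v \<notin> D"
      then have "{u \<in> D. u = v \<or> f u = v} = P" unfolding P_def by auto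
      then show False using big Pm by simp
    qed
    then have "{u \<in> D. u = v \<or> f u = v} = insert v P" unfolding P_def by auto
    then have "card P \<ge> m" using big finP by (simp add: card_insert_if split: if_splits)
    then have cP: "card P = m" using Pm by simp
    then have PV: "P = {u \<in> V. f u = v}"
      using fibre[of v] fin DV unfolding P_def by (intro card_seteq) auto
    have Pne: "P \<noteq> {}" using cP m by auto
    have vP: "v \<notin> P" unfolding P_def using fne v by auto
    have wv: "w \<noteq> v" "w \<in> V" unfolding w_def using fne fV v by auto
    \<comment> \<open>All \<open>m\<close> elements of \<open>P\<close> are counted by
      \<open>\<Phi>\<close> because of \<open>v \<in> D\<close>, and stop being counted once
      \<open>v\<close> is dropped.\<close>
    have Psub: "P \<subseteq> {a \<in> D. f a \<in> D}" unfolding P_def using vD by auto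
    have finE: "finite {a \<in> D. f a \<in> D}" using finD by simp
    have cE: "card ({a \<in> D. f a \<in> D} - P) + m = \<Phi> D"
      unfolding \<Phi>_def using card_Diff_subset[OF finP Psub] card_mono[OF finE Psub] cP by simp
    \<comment> \<open>Dropping \<open>v\<close> from \<open>D\<close> lowers \<open>\<Phi>\<close> by \<open>m \<ge> 2\<close>; if this uncovers \<open>w\<close>, adding \<open>w\<close> raises \<open>\<Phi>\<close> by at most 1.\<close>
    show False
    proof (cases "w \<in> D \<or> (\<exists>u\<in>D - {v}. f u = w)")
      case True
      have "covers (D - {v})" unfolding covers_def
      proof (intro conjI ballI)
        fix x assume x: "x \<in> V"
        show "x \<in> D - {v} \<or> (\<exists>u\<in>D - {v}. f u = x)"
        proof (cases "x = v")
          case True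
          then show ?thesis using Pne vP unfolding P_def by auto
        next
          case False
          then show ?thesis using cov[OF x] True wv unfolding w_def by auto
        qed
      qed (use DV in auto)
      moreover have "\<Phi> (D - {v}) \<le> card ({a \<in> D. f a \<in> D} - P)"
        unfolding \<Phi>_def P_def by (rule card_mono) (use finD in auto)
      ultimately show False using Dmin cE m by fastforce
    next
      case False
      have "covers (insert w (D - {v}))" unfolding covers_def
      proof (intro conjI ballI)
        fix x assume x: "x \<in> V"
        show "x \<in> insert w (D - {v}) \<or> (\<exists>u\<in>insert w (D - {v}). f u = x)"
        proof (cases "x = v")
          case True
          then show ?thesis using Pne vP unfolding P_def by auto
        next
          case False
          then show ?thesis using cov[OF x] wv unfolding w_def by auto
        qed
      qed (use DV wv in auto)
      \<comment> \<open>No element of \<open>D - {v}\<close> is mapped to \<open>w\<close>, so only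
        \<open>w\<close> itself can be newly counted.\<close>
      moreover have "\<Phi> (insert w (D - {v})) \<le> card (insert w ({a \<in> D. f a \<in> D} - P))"
        unfolding \<Phi>_def P_def by (rule card_mono) (use finD False wv in auto)
      moreover have "\<dots> \<le> Suc (card ({a \<in> D. f a \<in> D} - P))"
        by (simp add: card_insert_if finD)
      ultimately show False using Dmin cE m by fastforce
    qed
  qed
  then show ?thesis using DV cov by blast
qed

section \<open>Basic facts on simple graphs\<close>

lemma simple_graph_finite_edges:
  assumes "simple_graph G" shows "finite (edges G)"
proof -
  have "edges G \<subseteq> Pow (verts G)" using assms unfolding simple_graph_def by auto
  then show ?thesis using assms unfolding simple_graph_def by (metis finite_Pow_iff finite_subset)
qed

lemma simple_graph_edgeE:
  assumes "simple_graph G" "e \<in> edges G" "x \<in> e"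
  obtains y where "e = {x, y}" "y \<noteq> x" "x \<in> verts G" "y \<in> verts G"
proof -
  have "card e = 2" "e \<subseteq> verts G" using assms unfolding simple_graph_def by auto
  then obtain a b where "e = {a, b}" "a \<noteq> b" by (meson card_2_iff)
  then show thesis using that assms(3) \<open>e \<subseteq> verts G\<close> by (metis doubleton_eq_iff insertE insert_subset singletonD)
qed

lemma simple_graph_delete_verts: "simple_graph G \<Longrightarrow> simple_graph (delete_verts G S)"
  unfolding simple_graph_def delete_verts_def by auto

lemma simple_graph_delete_edges: "simple_graph G \<Longrightarrow> simple_graph (delete_edges G F)"
  unfolding simple_graph_def delete_edges_def by auto

lemma degree_eq_0_iff:
  assumes "simple_graph G"
  shows "degree G x = 0 \<longleftrightarrow> (\<forall>e\<in>edges G. x \<notin> e)"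
  unfolding degree_def using simple_graph_finite_edges[OF assms] by auto

section \<open>The star-factor criterion\<close>

lemma star_factor_criterion:
  assumes G: "simple_graph G" and m: "m \<ge> 2"
    and iso: "\<And>S. S \<subseteq> verts G \<Longrightarrow> num_isolated (delete_verts G S) \<le> m * card S"
  shows "\<exists>H. star_factor m H G"
proof -
  define N where "N v = {u \<in> verts G. {v, u} \<in> edges G}" for v
  have finV: "finite (verts G)" using G unfolding simple_graph_def by simp
  have irrefl: "u \<noteq> v" if "u \<in> N v" for u v
    using that G unfolding N_def simple_graph_def by force
  have hall: "card W \<le> m * card (\<Union>(N ` W))" if W: "W \<subseteq> verts G" for W
  proof -
    \<comment> \<open>Deleting the neighbourhood \<open>S\<close> of \<open>I\<close> isolates all
      of \<open>I\<close>, so the hypothesis bounds \<open>card I\<close> by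
      \<open>m * card S\<close>. The vertices of \<open>W - I\<close> have neighbours in
      \<open>W\<close>, hence lie in the neighbourhood of \<open>W\<close> themselves, and they are
      disjoint from \<open>S\<close>.\<close>
    define I where "I = {w \<in> W. N w \<inter> W = {}}"
    define S where "S = \<Union>(N ` I)"
    have finW: "finite W" using W finV finite_subset by blast
    have finN: "finite (\<Union>(N ` W))" using finV by (rule finite_subset[rotated]) (auto simp: N_def)
    have SV: "S \<subseteq> verts G" unfolding S_def N_def by auto
    have SW: "S \<inter> W = {}" unfolding S_def I_def by auto
    have "I \<subseteq> {x \<in> verts (delete_verts G S). degree (delete_verts G S) x = 0}"
    proof
      fix x assume x: "x \<in> I"
      then have "x \<in> W" unfolding I_def by simp
      then have "x \<in> verts (delete_verts G S)" using SW W by (auto simp: delete_verts_def)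
      moreover have "x \<notin> e" if e: "e \<in> edges (delete_verts G S)" for e
      proof
        assume "x \<in> e"
        moreover have eG: "e \<in> edges G" "e \<inter> S = {}" using e by (auto simp: delete_verts_def)
        ultimately obtain y where "e = {x, y}" "y \<in> verts G"
          using simple_graph_edgeE[OF G] by metis
        then have "y \<in> S" using eG x unfolding S_def N_def by auto
        then show False using eG \<open>e = {x, y}\<close> by auto
      qed
      ultimately show "x \<in> {x \<in> verts (delete_verts G S). degree (delete_verts G S) x = 0}"
        using degree_eq_0_iff[OF simple_graph_delete_verts[OF G]] by auto
    qed
    then have "card I \<le> num_isolated (delete_verts G S)"
      unfolding num_isolated_def using finV by (intro card_mono) (auto simp: delete_verts_def)
    then have cI: "card I \<le> m * card S" using iso[OF SV] by simp
    have sub: "S \<union> (W - I) \<subseteq> \<Union>(N ` W)"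
    proof
      fix x assume "x \<in> S \<union> (W - I)"
      then consider "x \<in> S" | "x \<in> W" "x \<notin> I" by blast
      then show "x \<in> \<Union>(N ` W)"
      proof cases
        case 1
        then show ?thesis unfolding S_def I_def by auto
      next
        case 2
        then obtain y where "y \<in> N x" "y \<in> W" unfolding I_def by auto
        then have "x \<in> N y" using 2 W unfolding N_def by (auto simp: insert_commute)
        then show ?thesis using \<open>y \<in> W\<close> by auto
      qed
    qed
    have "card W = card I + card (W - I)"
      using finW card_Diff_subset[of I W] card_mono[of W I] finite_subset[of I W] by (simp add: I_def)
    also have "\<dots> \<le> m * card S + m * card (W - I)" using cI m by (simp add: add_mono)
    also have "\<dots> = m * card (S \<union> (W - I))"
      using SW finW finite_subset[OF SV finV] by (subst card_Un_disjoint) (auto simp: algebra_simps)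
    also have "\<dots> \<le> m * card (\<Union>(N ` W))" using card_mono[OF finN sub] by simp
    finally show ?thesis .
  qed
  have "finite (N v)" for v unfolding N_def using finV by simp
  then obtain f where f: "\<forall>v\<in>verts G. f v \<in> N v" "\<And>b. card {v \<in> verts G. f v = b} \<le> m"
    using hall_capacity[of "verts G" N m] finV hall by auto
  have fV: "f v \<in> verts G" and fne: "f v \<noteq> v" if "v \<in> verts G" for v
    using f(1) that irrefl unfolding N_def by auto
  obtain D where D: "D \<subseteq> verts G" "\<And>v. v \<in> verts G \<Longrightarrow> v \<in> D \<or> (\<exists>u\<in>D. f u = v)"
    "\<And>v. v \<in> verts G \<Longrightarrow> card {u \<in> D. u = v \<or> f u = v} \<le> m"
    using functional_cover_bounded_degree[of "verts G" f m, OF finV fV fne f(2) m] by blast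
  define H where "H = \<lparr>verts = verts G, edges = (\<lambda>a. {a, f a}) ` D\<rparr>"
  have "edges H \<subseteq> edges G" using f(1) D(1) unfolding H_def N_def by auto
  then have span: "spanning_subgraph H G"
    using G D(1) fV unfolding spanning_subgraph_def simple_graph_def H_def by auto
  have "1 \<le> degree H v \<and> degree H v \<le> m" if v: "v \<in> verts G" for v
  proof
    have "degree H v \<noteq> 0"
      using span D(2)[OF v] unfolding spanning_subgraph_def by (auto simp: degree_eq_0_iff H_def)
    then show "1 \<le> degree H v" by simp
    have finD: "finite D" using D(1) finV finite_subset by blast
    have "{e \<in> edges H. v \<in> e} = (\<lambda>a. {a, f a}) ` {u \<in> D. u = v \<or> f u = v}"
      unfolding H_def by auto
    \<comment> \<open>Only an inequality: if \<open>f\<close> swaps two elements of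
      \<open>D\<close>, both give the same edge.\<close>
    then have "degree H v \<le> card {u \<in> D. u = v \<or> f u = v}"
      unfolding degree_def using finD by (simp add: card_image_le)
    then show "degree H v \<le> m" using D(3)[OF v] by simp
  qed
  then show ?thesis using span unfolding star_factor_def interval_factor_def by blast
qed

section \<open>Isolated vertices and isolated toughness\<close>

text \<open>A vertex that becomes isolated only by the removal of \<open>F\<close> is an end of an
  edge in \<open>F\<close>, and there are at most \<open>2 * card F\<close> such ends.\<close>

lemma num_isolated_delete_edges_le:
  assumes G: "simple_graph G" and F: "F \<subseteq> edges G"
  shows "num_isolated (delete_verts (delete_edges G F) S) \<le> num_isolated (delete_verts G S) + 2 * card F"
proof -
  let ?I = "\<lambda>G. {x \<in> verts (delete_verts G S). degree (delete_verts G S) x = 0}"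
  have finF: "finite F" using F simple_graph_finite_edges[OF G] finite_subset by blast
  have finV: "finite (verts G)" using G unfolding simple_graph_def by simp
  have c2: "card e = 2" if "e \<in> F" for e using that F G unfolding simple_graph_def by auto
  then have finUF: "finite (\<Union>F)" using finF by (metis card.infinite finite_Union zero_neq_numeral)
  have "?I (delete_edges G F) \<subseteq> ?I G \<union> \<Union>F"
    using degree_eq_0_iff[OF simple_graph_delete_verts[OF G]]
      degree_eq_0_iff[OF simple_graph_delete_verts[OF simple_graph_delete_edges[OF G]]]
    by (auto simp: delete_verts_def delete_edges_def)
  then have "card (?I (delete_edges G F)) \<le> card (?I G \<union> \<Union>F)"
    using finUF finV by (intro card_mono) (auto simp: delete_verts_def)
  also have "\<dots> \<le> card (?I G) + card (\<Union>F)" by (rule card_Un_le)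
  also have "card (\<Union>F) \<le> (\<Sum>e\<in>F. card e)" by (rule card_Union_le_sum_card)
  also have "(\<Sum>e\<in>F. card e) = 2 * card F" using c2 by simp
  finally show ?thesis unfolding num_isolated_def by simp
qed

lemma num_isolated_complete_le_1:
  assumes G: "simple_graph G" and "complete_graph G"
  shows "num_isolated (delete_verts G S) \<le> 1"
proof -
  let ?I = "{x \<in> verts (delete_verts G S). degree (delete_verts G S) x = 0}"
  have "x = y" if "x \<in> ?I" "y \<in> ?I" for x y
  proof (rule ccontr)
    assume "x \<noteq> y"
    then have "{x, y} \<in> edges (delete_verts G S)"
      using that assms(2) unfolding complete_graph_def delete_verts_def by auto
    then show False using that degree_eq_0_iff[OF simple_graph_delete_verts[OF G]] by auto
  qed
  moreover have "finite ?I" using G unfolding simple_graph_def delete_verts_def by simp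
  ultimately show ?thesis unfolding num_isolated_def by (metis (no_types, lifting) One_nat_def card_le_Suc0_iff_eq)
qed

text \<open>Two isolated vertices rule out a complete graph, so the toughness is the minimum of the
  quotients, one of which comes from \<open>S\<close>.\<close>

lemma isolated_toughness_le:
  assumes G: "simple_graph G" and S: "S \<subseteq> verts G" and i: "num_isolated (delete_verts G S) \<ge> 2"
  shows "isolated_toughness G * real (num_isolated (delete_verts G S)) \<le> real (card S)"
proof -
  let ?q = "\<lambda>S. real (card S) / real (num_isolated (delete_verts G S))"
  let ?M = "{?q S | S. S \<subseteq> verts G \<and> num_isolated (delete_verts G S) \<ge> 2}"
  have nc: "\<not> complete_graph G" using num_isolated_complete_le_1[OF G, of S] i by auto
  have "?M \<subseteq> ?q ` Pow (verts G)" by auto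
  then have "finite ?M" using G unfolding simple_graph_def by (meson finite_Pow_iff finite_imageI finite_subset)
  then have "Min ?M \<le> ?q S" using S i by (intro Min_le) auto
  then have "isolated_toughness G \<le> ?q S" using nc by (simp add: isolated_toughness_def)
  then show ?thesis using i by (simp add: field_simps)
qed

theorem theorem5:
  fixes G :: "'a graph" and m n :: nat and E' :: "'a set set"
  assumes "m > 0" and "n \<ge> 1" and "real n \<le> real m / 2"
    and "simple_graph G"
    and "min_degree G \<ge> 1 + n"
    and "isolated_toughness G \<ge> 1 / (real m - real n)"
    and "E' \<subseteq> edges G" and "card E' = n"
  shows "\<exists>H. star_factor m H (delete_edges G E')"
proof (rule star_factor_criterion)
  let ?H = "delete_edges G E'"
  note G = assms(4)
  have mn: "2 * n \<le> m" using assms(3) by linarith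
  show "m \<ge> 2" using mn assms(2) by linarith
  show H: "simple_graph ?H" using simple_graph_delete_edges[OF G] .
  have finV: "finite (verts G)" using G unfolding simple_graph_def by simp
  have finE: "finite (edges G)" using simple_graph_finite_edges[OF G] .
  have finE': "finite E'" using finE assms(7) finite_subset by blast
  have deg: "degree G x \<ge> 1 + n" if "x \<in> verts G" for x
    using that assms(5) finV unfolding min_degree_def
    by (metis Min_le finite_imageI imageI le_trans)
  fix S assume "S \<subseteq> verts ?H"
  then have S: "S \<subseteq> verts G" by (simp add: delete_edges_def)
  have finS: "finite S" using S finV finite_subset by blast
  let ?I = "{x \<in> verts (delete_verts ?H S). degree (delete_verts ?H S) x = 0}"
  show "num_isolated (delete_verts ?H S) \<le> m * card S"
  proof (rule ccontr)
    assume "\<not> ?thesis"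
    then have big: "card ?I > m * card S" unfolding num_isolated_def by simp
    have le: "card ?I \<le> num_isolated (delete_verts G S) + 2 * n"
      using num_isolated_delete_edges_le[OF G assms(7), of S] assms(8) unfolding num_isolated_def by simp
    have S1: "card S \<le> 1"
    proof (cases "num_isolated (delete_verts G S) \<ge> 2")
      case True
      let ?i = "num_isolated (delete_verts G S)"
      have pos: "real m - real n > 0" using mn assms(2) by linarith
      have "1 / (real m - real n) * real ?i \<le> real (card S)"
        using isolated_toughness_le[OF G S True] assms(6)
        by (meson mult_right_mono of_nat_0_le_iff order_trans)
      then have "real ?i \<le> real (card S) * (real m - real n)" using pos by (simp add: field_simps)
      moreover have "real (m * card S) < real ?i + 2 * real n" using big le by linarith
      \<comment> \<open>Inserting the toughness bound on \<open>?i\<close> cancels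
        \<open>m * card S\<close> and leaves \<open>n * card S < 2 * n\<close>.\<close>
      ultimately have "real n * real (card S) < real n * 2" by (simp add: algebra_simps)
      then show ?thesis using assms(2) by (simp add: mult_less_cancel_left_pos)
    next
      case False
      \<comment> \<open>With at most one isolated vertex in \<open>G - S\<close>,
        \<open>m * card S < 1 + 2 * n \<le> 1 + m\<close>.\<close>
      then have "m * card S \<le> m * 1" using big le mn by linarith
      then show ?thesis using assms(1) by simp
    qed
    \<comment> \<open>A vertex isolated in \<open>G - E' - S\<close> with \<open>|S| \<le> 1\<close> has lost at least \<open>n\<close> edges, so it lies on every edge of \<open>E'\<close>.\<close>
    have all: "card S = 1 \<and> (\<forall>e\<in>E'. x \<in> e)" if x: "x \<in> ?I" for x
    proof -
      let ?A = "{e \<in> E'. x \<in> e}"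
      have xV: "x \<in> verts G" and xS: "x \<notin> S" using x by (auto simp: delete_verts_def delete_edges_def)
      \<comment> \<open>Since \<open>x\<close> is isolated after both deletions, each of its edges
        in \<open>G\<close> belongs to \<open>E'\<close> or ends in \<open>S\<close>.\<close>
      have "{e \<in> edges G. x \<in> e} \<subseteq> ?A \<union> (\<lambda>s. {x, s}) ` S"
      proof
        fix e assume "e \<in> {e \<in> edges G. x \<in> e}"
        then have e: "e \<in> edges G" "x \<in> e" by auto
        obtain y where y: "e = {x, y}" using simple_graph_edgeE[OF G e] by blast
        have "e \<in> E' \<or> e \<inter> S \<noteq> {}"
          using x e degree_eq_0_iff[OF simple_graph_delete_verts[OF H]]
          by (auto simp: delete_verts_def delete_edges_def)
        then show "e \<in> ?A \<union> (\<lambda>s. {x, s}) ` S" using y xS e by auto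
      qed
      then have "degree G x \<le> card (?A \<union> (\<lambda>s. {x, s}) ` S)"
        unfolding degree_def using finE' finS by (intro card_mono) auto
      also have "\<dots> \<le> card ?A + card S"
        using card_Un_le[of ?A "(\<lambda>s. {x, s}) ` S"] card_image_le[OF finS, of "\<lambda>s. {x, s}"] by linarith
      finally have ge: "1 + n \<le> card ?A + card S" using deg[OF xV] by linarith
      have "card ?A \<le> n" using card_mono[OF finE', of ?A] assms(8) by auto
      \<comment> \<open>The two summands are at most \<open>n\<close> and \<open>1\<close> but add
        up to at least \<open>1 + n\<close>, so both bounds are attained.\<close>
      then have "card S = 1" "card ?A = card E'" using ge S1 assms(8) by linarith+
      moreover have "?A = E'" using calculation(2) finE' by (intro card_subset_eq) auto
      ultimately show ?thesis by blast
    qed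
    have "?I \<noteq> {}" using big by (metis card.empty not_less0)
    then have "card S = 1" using all by blast
    then have "card ?I > 2" using big mn assms(2) by simp
    \<comment> \<open>One edge suffices: all the more than two vertices of \<open>?I\<close> would
      be among its two ends.\<close>
    obtain e where e: "e \<in> E'" using assms(2,8) by fastforce
    then have "card e = 2" using assms(7) G unfolding simple_graph_def by auto
    moreover have "card ?I \<le> card e"
      using all e \<open>card e = 2\<close> by (intro card_mono) (auto intro: card_ge_0_finite)
    ultimately show False using \<open>card ?I > 2\<close> by simp
  qed
qed

end
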